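(* Let $R$ be a subring of a field $E$ and let $t$ be an element with $$0\ne t\in R,\qquad 1\notin tR,\qquad E=R[t^{-1}].$$ Suppose that $R$ contains a totally ordered subfield $F$. Then $$P_R=\{0\}\cup\bigcup_{n\in\mathbb{Z}}t^{-n}(F_{>0}+tR)$$ is the positive cone of a directed ring order on $E$. It contains $1$ and satisfies $$(P_R\setminus\{0\})^{-1}=P_R\setminus\{0\}.$$ Moreover, if $z\in E$ and $t^mz\in R$ for some integer $m\ge 0$, then $N=m+1$ satisfies $$t^{-N}+z,\ t^{-N}-z\in P_R\setminus\{0\}.$$
   Context: Subrings contain the identity of the ambient field. A totally ordered subfield means a subfield $F$ equipped with a total order making it an ordered field; $F_{>0}$ is its set of positive elements, and $F_{>0}+tR=\{a+tr: a\in F_{>0}, r\in R\}$. A positive cone in a field $E$ is a subset $P\subseteq E$ with $P+P\subseteq P$, $PP\subseteq P$ and $P\cap(-P)=\{0\}$. It defines a ring order on $E$ by $x\preceq y$ iff $y-x\in P$. The order is directed if every pair of elements has a common upper bound and a common lower bound; equivalently, $P-P=E$. *)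

theory Defs
  imports "HOL-Algebra.Algebra"
begin

definition ring_order :: "('a, 'b) ring_scheme \<Rightarrow> 'a rel \<Rightarrow> bool" where
  "ring_order A ord \<longleftrightarrow>
     partial_order_on (carrier A) ord \<and>
     (\<forall>x\<in>carrier A. \<forall>y\<in>carrier A. \<forall>z\<in>carrier A.
        (x, y) \<in> ord \<longrightarrow> (x \<oplus>\<^bsub>A\<^esub> z, y \<oplus>\<^bsub>A\<^esub> z) \<in> ord) \<and>
     (\<forall>x\<in>carrier A. \<forall>y\<in>carrier A.
        (\<zero>\<^bsub>A\<^esub>, x) \<in> ord \<longrightarrow> (\<zero>\<^bsub>A\<^esub>, y) \<in> ord \<longrightarrow> (\<zero>\<^bsub>A\<^esub>, x \<otimes>\<^bsub>A\<^esub> y) \<in> ord)"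

definition directed_order :: "'a set \<Rightarrow> 'a rel \<Rightarrow> bool" where
  "directed_order A ord \<longleftrightarrow>
     (\<forall>x\<in>A. \<forall>y\<in>A.
        (\<exists>u\<in>A. (x, u) \<in> ord \<and> (y, u) \<in> ord) \<and>
        (\<exists>l\<in>A. (l, x) \<in> ord \<and> (l, y) \<in> ord))"

definition totally_ordered_subfield :: "('a, 'b) ring_scheme \<Rightarrow> 'a set \<Rightarrow> 'a rel \<Rightarrow> bool" where
  "totally_ordered_subfield E F ord \<longleftrightarrow>
     subfield F E \<and> linear_order_on F ord \<and> ring_order (E\<lparr>carrier := F\<rparr>) ord"

definition positive_elements :: "('a, 'b) ring_scheme \<Rightarrow> 'a set \<Rightarrow> 'a rel \<Rightarrow> 'a set" where
  "positive_elements E F ord = {a \<in> F. (\<zero>\<^bsub>E\<^esub>, a) \<in> ord \<and> a \<noteq> \<zero>\<^bsub>E\<^esub>}"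

definition positive_cone :: "('a, 'b) ring_scheme \<Rightarrow> 'a set \<Rightarrow> bool" where
  "positive_cone E P \<longleftrightarrow>
     P \<subseteq> carrier E \<and>
     (P <+>\<^bsub>E\<^esub> P) \<subseteq> P \<and>
     (P <#>\<^bsub>E\<^esub> P) \<subseteq> P \<and>
     P \<inter> (a_set_inv\<^bsub>E\<^esub> P) = {\<zero>\<^bsub>E\<^esub>}"

definition cone_order :: "('a, 'b) ring_scheme \<Rightarrow> 'a set \<Rightarrow> 'a rel" where
  "cone_order E P = {(x, y). x \<in> carrier E \<and> y \<in> carrier E \<and> y \<ominus>\<^bsub>E\<^esub> x \<in> P}"

definition positive_cone_of_directed_ring_order :: "('a, 'b) ring_scheme \<Rightarrow> 'a set \<Rightarrow> bool" where
  "positive_cone_of_directed_ring_order E P \<longleftrightarrow>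
     positive_cone E P \<and>
     ring_order E (cone_order E P) \<and>
     directed_order (carrier E) (cone_order E P)"

text \<open>The set \<open>P\<^sub>R\<close>; the exponent \<open>- n\<close> is an integer, so the power is taken in the
  unit group of \<open>E\<close>.\<close>

definition P_cone :: "('a, 'b) ring_scheme \<Rightarrow> 'a set \<Rightarrow> 'a set \<Rightarrow> 'a rel \<Rightarrow> 'a \<Rightarrow> 'a set" where
  "P_cone E R F ord t =
     {\<zero>\<^bsub>E\<^esub>} \<union>
     (\<Union>n::int. (t [^]\<^bsub>E\<^esub> (- n)) <#\<^bsub>E\<^esub>
        (positive_elements E F ord <+>\<^bsub>E\<^esub> (t <#\<^bsub>E\<^esub> R)))"

end

theory Submission
  imports Defs
begin

text \<open>
  Write \<open>Q\<close> for the positive elements of \<open>F\<close> and \<open>U = Q + tR\<close>. The elements of \<open>U\<close> behave like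
  power series in \<open>t\<close> with positive constant term, and \<open>t\<^sup>nU\<close> like Laurent series with leading
  term of degree \<open>n\<close> and positive leading coefficient. The claim then rests on four properties.

  \<^item> \<open>U\<close> is closed under multiplication and addition and absorbs \<open>tR\<close>. Hence the union \<open>P\<close> of
    all \<open>t\<^sup>nU\<close> is closed under multiplication, and also under addition, since in
    \<open>t\<^sup>mu + t\<^sup>nv\<close> with \<open>m \<le> n\<close> one can factor out \<open>t\<^sup>m\<close> (\<open>P_add\<close>).
  \<^item> \<open>0 \<notin> U\<close>: from \<open>a + tr = 0\<close> with \<open>a\<close> in \<open>Q\<close> the element \<open>t\<close> would be invertible in \<open>R\<close>
    (\<open>zero_notin_U\<close>). Hence \<open>0 \<notin> P\<close>, and since \<open>P\<close> is closed under addition, no element of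
    \<open>P\<close> has its negative in \<open>P\<close>.
  \<^item> \<open>U\<close> is closed under inverses (\<open>U_inv\<close>). Because \<open>E = R[t\<inverse>]\<close>, the inverse of \<open>u \<in> U\<close> is
    \<open>t\<^sup>-\<^sup>ks\<close> with \<open>s \<in> R\<close>. Modulo \<open>t\<close>, the element \<open>u\<close> is a unit of \<open>R\<close>, so \<open>us = t\<^sup>k\<close> allows
    the powers of \<open>t\<close> to be cancelled from \<open>s\<close> (\<open>divisor_of_t_pow_in_U\<close>), and \<open>w = u\<inverse>\<close> lies in
    \<open>R\<close>. With \<open>u = a + tr\<close> one reads off \<open>w = a\<inverse> + t(-a\<inverse>rw)\<close>, an element of \<open>U\<close>.
  \<^item> If \<open>t\<^sup>mz \<in> R\<close>, then \<open>t\<^sup>-\<^sup>m\<^sup>-\<^sup>1 \<plusminus> z = t\<^sup>-\<^sup>m\<^sup>-\<^sup>1(1 \<plusminus> t(t\<^sup>mz))\<close> lies in \<open>P\<close>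
    (\<open>t_pow_dominates\<close>). As every \<open>z\<close> in \<open>E\<close> has such an \<open>m\<close>, the order is directed.
\<close>

section \<open>Integer powers of units\<close>

context monoid
begin

lemma units_of_int_pow:
  assumes "x \<in> Units G"
  shows "x [^]\<^bsub>units_of G\<^esub> (n::int) = x [^] n"
  unfolding int_pow_def2 using assms
  by (simp add: units_of_pow units_of_inv Units_pow_closed del: pow_nat)

lemma int_pow_Units:
  assumes "x \<in> Units G"
  shows "x [^] (n::int) \<in> Units G"
  using group.int_pow_closed[OF units_group, of x n] assms
  by (simp add: units_of_carrier units_of_int_pow)

lemma int_pow_mult_Units:
  assumes "x \<in> Units G"
  shows "x [^] (m + n :: int) = x [^] m \<otimes> x [^] n"
  using group.int_pow_mult[OF units_group, of x m n] assms
  by (simp add: units_of_carrier units_of_int_pow units_of_mult)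

end

section \<open>Ring orders from positive cones\<close>

lemma (in ring) positive_coneI:
  assumes "P \<subseteq> carrier R" and "\<zero> \<in> P"
    and "\<And>x y. x \<in> P \<Longrightarrow> y \<in> P \<Longrightarrow> x \<oplus> y \<in> P"
    and "\<And>x y. x \<in> P \<Longrightarrow> y \<in> P \<Longrightarrow> x \<otimes> y \<in> P"
    and "\<And>x. x \<in> P \<Longrightarrow> \<ominus> x \<in> P \<Longrightarrow> x = \<zero>"
  shows "positive_cone R P"
proof -
  have "P \<inter> a_set_inv\<^bsub>R\<^esub> P = {\<zero>}"
  proof (intro equalityI subsetI)
    fix x assume "x \<in> P \<inter> a_set_inv\<^bsub>R\<^esub> P"
    then obtain y where y: "y \<in> P" "x = \<ominus> y" "x \<in> P"
      by (auto simp: A_SET_INV_def')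
    then have "y = \<zero>" using assms(5) by blast
    then show "x \<in> {\<zero>}" using y by simp
  next
    fix x assume "x \<in> {\<zero>}"
    moreover have "\<zero> = \<ominus> \<zero>" by simp
    ultimately show "x \<in> P \<inter> a_set_inv\<^bsub>R\<^esub> P"
      using assms(2) unfolding A_SET_INV_def' by blast
  qed
  then show ?thesis
    using assms(1,3,4) unfolding positive_cone_def set_add_def' set_mult_def by auto
qed

lemma (in ring) positive_coneD:
  assumes "positive_cone R P"
  shows "P \<subseteq> carrier R" and "\<zero> \<in> P"
    and "\<And>x y. x \<in> P \<Longrightarrow> y \<in> P \<Longrightarrow> x \<oplus> y \<in> P"
    and "\<And>x y. x \<in> P \<Longrightarrow> y \<in> P \<Longrightarrow> x \<otimes> y \<in> P"
    and "\<And>x. x \<in> P \<Longrightarrow> \<ominus> x \<in> P \<Longrightarrow> x = \<zero>"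
proof -
  show carr: "P \<subseteq> carrier R" and "\<zero> \<in> P"
    and "\<And>x y. x \<in> P \<Longrightarrow> y \<in> P \<Longrightarrow> x \<oplus> y \<in> P"
    and "\<And>x y. x \<in> P \<Longrightarrow> y \<in> P \<Longrightarrow> x \<otimes> y \<in> P"
    using assms unfolding positive_cone_def set_add_def' set_mult_def by blast+
  fix x assume x: "x \<in> P" "\<ominus> x \<in> P"
  then have "x = \<ominus> (\<ominus> x)" using carr by auto
  then have "x \<in> P \<inter> a_set_inv\<^bsub>R\<^esub> P" using x unfolding A_SET_INV_def' by blast
  then show "x = \<zero>" using assms unfolding positive_cone_def by blast
qed

lemma (in ring) ring_order_cone_order:
  assumes "positive_cone R P"
  shows "ring_order R (cone_order R P)"
proof -
  note P = positive_coneD[OF assms]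
  have "refl_on (carrier R) (cone_order R P)"
    using P(2) by (auto simp: refl_on_def cone_order_def minus_eq r_neg)
  moreover have "trans (cone_order R P)"
  proof (rule transI)
    fix x y z assume "(x, y) \<in> cone_order R P" "(y, z) \<in> cone_order R P"
    then have c: "x \<in> carrier R" "y \<in> carrier R" "z \<in> carrier R"
      and "(z \<ominus> y) \<oplus> (y \<ominus> x) \<in> P"
      using P(3) by (auto simp: cone_order_def)
    moreover have "(z \<ominus> y) \<oplus> (y \<ominus> x) = z \<ominus> x" using c by algebra
    ultimately show "(x, z) \<in> cone_order R P" by (simp add: cone_order_def)
  qed
  moreover have "antisym (cone_order R P)"
  proof (rule antisymI)
    fix x y assume "(x, y) \<in> cone_order R P" "(y, x) \<in> cone_order R P"
    then have c: "x \<in> carrier R" "y \<in> carrier R" and "y \<ominus> x \<in> P" "x \<ominus> y \<in> P"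
      by (auto simp: cone_order_def)
    moreover have "x \<ominus> y = \<ominus> (y \<ominus> x)" using c by algebra
    ultimately have "y \<ominus> x = \<zero>" using P(5) by metis
    then show "x = y" using c by simp
  qed
  moreover have "(x \<oplus> z, y \<oplus> z) \<in> cone_order R P"
    if "(x, y) \<in> cone_order R P" "z \<in> carrier R" for x y z
  proof -
    have c: "x \<in> carrier R" "y \<in> carrier R" using that by (auto simp: cone_order_def)
    then have "(y \<oplus> z) \<ominus> (x \<oplus> z) = y \<ominus> x" using that(2) by algebra
    then show ?thesis using that c by (simp add: cone_order_def)
  qed
  moreover have "(\<zero>, x \<otimes> y) \<in> cone_order R P"
    if "(\<zero>, x) \<in> cone_order R P" "(\<zero>, y) \<in> cone_order R P" for x y
    using that P(4) by (auto simp: cone_order_def minus_eq)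
  moreover have "cone_order R P \<subseteq> carrier R \<times> carrier R"
    by (auto simp: cone_order_def)
  ultimately show ?thesis
    unfolding ring_order_def partial_order_on_def preorder_on_def by blast
qed

text \<open>If \<open>p\<close> dominates \<open>\<plusminus>x\<close> and \<open>q\<close> dominates \<open>\<plusminus>y\<close>, then
  \<open>p + q\<close> lies above \<open>x\<close> and \<open>y\<close>, and \<open>-(p + q)\<close> lies below both.\<close>

lemma (in ring) directed_cone_order:
  assumes "positive_cone R P"
    and dom: "\<And>x. x \<in> carrier R \<Longrightarrow> \<exists>p\<in>P. p \<oplus> x \<in> P \<and> p \<ominus> x \<in> P"
  shows "directed_order (carrier R) (cone_order R P)"
  unfolding directed_order_def
proof (intro ballI)
  note P = positive_coneD[OF assms(1)]
  fix x y assume c: "x \<in> carrier R" "y \<in> carrier R"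
  obtain p where p: "p \<in> P" "p \<oplus> x \<in> P" "p \<ominus> x \<in> P" using dom c by blast
  obtain q where q: "q \<in> P" "q \<oplus> y \<in> P" "q \<ominus> y \<in> P" using dom c by blast
  have pq: "p \<in> carrier R" "q \<in> carrier R" using p q P(1) by auto
  have "(p \<oplus> q) \<ominus> x = q \<oplus> (p \<ominus> x)" "(p \<oplus> q) \<ominus> y = p \<oplus> (q \<ominus> y)"
    "x \<ominus> (\<ominus> (p \<oplus> q)) = q \<oplus> (p \<oplus> x)" "y \<ominus> (\<ominus> (p \<oplus> q)) = p \<oplus> (q \<oplus> y)"
    using c pq by algebra+
  then have "(x, p \<oplus> q) \<in> cone_order R P" "(y, p \<oplus> q) \<in> cone_order R P"
    "(\<ominus> (p \<oplus> q), x) \<in> cone_order R P" "(\<ominus> (p \<oplus> q), y) \<in> cone_order R P"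
    using c pq p q P(3) by (simp_all add: cone_order_def)
  then show "(\<exists>u\<in>carrier R. (x, u) \<in> cone_order R P \<and> (y, u) \<in> cone_order R P) \<and>
      (\<exists>l\<in>carrier R. (l, x) \<in> cone_order R P \<and> (l, y) \<in> cone_order R P)"
    using pq by (meson a_inv_closed a_closed)
qed

section \<open>Positive elements of a totally ordered subfield\<close>

context field
begin

lemma totally_ordered_subfieldD:
  assumes "totally_ordered_subfield R F ord"
  shows "subring F R"
    and "\<And>x. x \<in> F \<Longrightarrow> x \<noteq> \<zero> \<Longrightarrow> inv x \<in> F"
    and "\<And>x y. x \<in> F \<Longrightarrow> y \<in> F \<Longrightarrow> x \<noteq> y \<Longrightarrow> (x, y) \<in> ord \<or> (y, x) \<in> ord"
    and "trans ord" and "antisym ord"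
    and "\<And>x y z. x \<in> F \<Longrightarrow> y \<in> F \<Longrightarrow> z \<in> F \<Longrightarrow> (x, y) \<in> ord \<Longrightarrow> (x \<oplus> z, y \<oplus> z) \<in> ord"
    and "\<And>x y. x \<in> F \<Longrightarrow> y \<in> F \<Longrightarrow> (\<zero>, x) \<in> ord \<Longrightarrow> (\<zero>, y) \<in> ord \<Longrightarrow> (\<zero>, x \<otimes> y) \<in> ord"
proof -
  have sf: "subfield F R" and lin: "linear_order_on F ord" and ro: "ring_order (R\<lparr>carrier := F\<rparr>) ord"
    using assms unfolding totally_ordered_subfield_def by auto
  show "subring F R" by (rule subfieldE(1)[OF sf])
  show "inv x \<in> F" if "x \<in> F" "x \<noteq> \<zero>" for x
    using subfield_m_inv(1)[OF sf] that by blast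
  show "(x, y) \<in> ord \<or> (y, x) \<in> ord" if "x \<in> F" "y \<in> F" "x \<noteq> y" for x y
    using lin that by (auto simp: linear_order_on_def total_on_def)
  show "trans ord" "antisym ord"
    using lin by (auto simp: linear_order_on_def partial_order_on_def preorder_on_def)
  show "\<And>x y z. x \<in> F \<Longrightarrow> y \<in> F \<Longrightarrow> z \<in> F \<Longrightarrow> (x, y) \<in> ord \<Longrightarrow> (x \<oplus> z, y \<oplus> z) \<in> ord"
    and "\<And>x y. x \<in> F \<Longrightarrow> y \<in> F \<Longrightarrow> (\<zero>, x) \<in> ord \<Longrightarrow> (\<zero>, y) \<in> ord \<Longrightarrow> (\<zero>, x \<otimes> y) \<in> ord"
    using ro by (auto simp: ring_order_def)
qed

context
  fixes F ord
  assumes F: "totally_ordered_subfield R F ord"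
begin

lemma positive_or_negative:
  assumes "x \<in> F" "x \<noteq> \<zero>"
  shows "x \<in> positive_elements R F ord \<or> \<ominus> x \<in> positive_elements R F ord"
proof (cases "(\<zero>, x) \<in> ord")
  case True
  then show ?thesis using assms by (simp add: positive_elements_def)
next
  case False
  note sub = subringE[OF totally_ordered_subfieldD(1)[OF F]]
  have c: "x \<in> carrier R" using assms sub(1) by blast
  have "(x, \<zero>) \<in> ord"
    using totally_ordered_subfieldD(3)[OF F assms(1) sub(2) assms(2)] False by blast
  then have "(x \<oplus> \<ominus> x, \<zero> \<oplus> \<ominus> x) \<in> ord"
    using totally_ordered_subfieldD(6)[OF F assms(1) sub(2) sub(5)[OF assms(1)]] by blast
  then have "(\<zero>, \<ominus> x) \<in> ord" using c by (simp add: r_neg)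
  moreover have "\<ominus> x \<noteq> \<zero>" using c assms(2) by (metis minus_minus minus_zero)
  ultimately show ?thesis using sub(5)[OF assms(1)] by (simp add: positive_elements_def)
qed

lemma positive_elements_add:
  assumes "a \<in> positive_elements R F ord" "b \<in> positive_elements R F ord"
  shows "a \<oplus> b \<in> positive_elements R F ord"
proof -
  note D = totally_ordered_subfieldD[OF F]
  note sub = subringE[OF D(1)]
  have a: "a \<in> F" "(\<zero>, a) \<in> ord" "a \<noteq> \<zero>" and b: "b \<in> F" "(\<zero>, b) \<in> ord"
    using assms by (auto simp: positive_elements_def)
  have c: "a \<in> carrier R" "b \<in> carrier R" using a b sub(1) by auto
  have "(\<zero> \<oplus> a, b \<oplus> a) \<in> ord" using D(6)[OF sub(2) b(1) a(1) b(2)] .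
  then have ab: "(a, a \<oplus> b) \<in> ord" using c by (simp add: a_comm)
  then have "(\<zero>, a \<oplus> b) \<in> ord" using a(2) D(4) by (meson transD)
  moreover have "a \<oplus> b \<noteq> \<zero>"
    using ab a D(5) by (metis antisymD)
  ultimately show ?thesis using sub(7)[OF a(1) b(1)] by (simp add: positive_elements_def)
qed

lemma positive_elements_mult:
  assumes "a \<in> positive_elements R F ord" "b \<in> positive_elements R F ord"
  shows "a \<otimes> b \<in> positive_elements R F ord"
proof -
  note D = totally_ordered_subfieldD[OF F]
  note sub = subringE[OF D(1)]
  have a: "a \<in> F" "(\<zero>, a) \<in> ord" "a \<noteq> \<zero>" and b: "b \<in> F" "(\<zero>, b) \<in> ord" "b \<noteq> \<zero>"
    using assms by (auto simp: positive_elements_def)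
  then show ?thesis using D(7)[OF a(1) b(1) a(2) b(2)] sub(6)[OF a(1) b(1)] sub(1)
    by (auto simp: positive_elements_def integral_iff subsetD)
qed

text \<open>One of \<open>x\<close> and \<open>-x\<close> is positive, and both have the same square.\<close>

lemma square_positive:
  assumes "x \<in> F" "x \<noteq> \<zero>"
  shows "x \<otimes> x \<in> positive_elements R F ord"
proof -
  have "x \<in> carrier R" using assms subringE(1)[OF totally_ordered_subfieldD(1)[OF F]] by blast
  then have "\<ominus> x \<otimes> \<ominus> x = x \<otimes> x" by algebra
  then show ?thesis
    using positive_or_negative[OF assms] positive_elements_mult by metis
qed

lemma positive_elements_one: "\<one> \<in> positive_elements R F ord"
  using square_positive[of \<one>] subringE(3)[OF totally_ordered_subfieldD(1)[OF F]] by simp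

lemma positive_elements_inv:
  assumes "a \<in> positive_elements R F ord"
  shows "inv a \<in> positive_elements R F ord"
proof -
  note D = totally_ordered_subfieldD[OF F]
  note sub = subringE[OF D(1)]
  have a: "a \<in> F" "a \<noteq> \<zero>" using assms by (auto simp: positive_elements_def)
  then have U: "a \<in> Units R" using sub(1) by (auto simp: field_Units)
  then have "inv a \<in> Units R" by simp
  then have i: "inv a \<in> F" "inv a \<noteq> \<zero>" "inv a \<in> carrier R"
    using D(2) a by (auto simp: field_Units)
  \<comment> \<open>\<open>a\<inverse> = a (a\<inverse>)\<^sup>2\<close> is a product of positive elements.\<close>
  have "inv a = a \<otimes> (inv a \<otimes> inv a)"
    using U i by (simp add: m_assoc[symmetric] Units_closed)
  then show ?thesis
    using positive_elements_mult[OF assms square_positive[OF i(1,2)]] by simp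
qed

end

end

section \<open>Elements with positive leading coefficient\<close>

text \<open>The order of \<open>F\<close> enters the argument through the set \<open>Q\<close> of its positive elements,
  the possible leading coefficients: a strict cone closed under inverses.\<close>

locale positive_leading_coefficients = field E for E (structure) +
  fixes R :: "'a set" and t :: 'a and Q :: "'a set"
  assumes subring_R: "subring R E"
    and t_in_R: "t \<in> R" and t_nonzero: "t \<noteq> \<zero>"
    and one_notin_tR: "\<one> \<notin> t <# R"
    and generated: "carrier E = generate_ring E (R \<union> {inv t})"
    and Q_subset: "Q \<subseteq> R"
    and zero_notin_Q: "\<zero> \<notin> Q"
    and one_in_Q: "\<one> \<in> Q"
    and Q_add: "\<And>a b. a \<in> Q \<Longrightarrow> b \<in> Q \<Longrightarrow> a \<oplus> b \<in> Q"
    and Q_mult: "\<And>a b. a \<in> Q \<Longrightarrow> b \<in> Q \<Longrightarrow> a \<otimes> b \<in> Q"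
    and Q_inv: "\<And>a. a \<in> Q \<Longrightarrow> inv a \<in> Q"
begin

lemmas R_simps = subringE(2,3,5,6,7)[OF subring_R]

lemma R_closed: "x \<in> R \<Longrightarrow> x \<in> carrier E"
  using subringE(1)[OF subring_R] by blast

lemma R_diff: "x \<in> R \<Longrightarrow> y \<in> R \<Longrightarrow> x \<ominus> y \<in> R"
  by (simp add: minus_eq R_simps)

lemma t_Units: "t \<in> Units E"
  using R_closed[OF t_in_R] t_nonzero by (simp add: field_Units)

lemma t_closed: "t \<in> carrier E"
  using R_closed t_in_R .

lemma Q_Units: "a \<in> Q \<Longrightarrow> a \<in> Units E"
  using Q_subset zero_notin_Q R_closed by (auto simp: field_Units)

lemma t_nat_pow_in_R: "t [^] (k::nat) \<in> R"
  by (induction k) (auto simp: R_simps t_in_R)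

subsection \<open>Integer powers of \<open>t\<close>\<close>

lemma t_pow_Units: "t [^] (n::int) \<in> Units E"
  using int_pow_Units t_Units .

lemma t_pow_closed: "t [^] (n::int) \<in> carrier E"
  and t_pow_nonzero: "t [^] (n::int) \<noteq> \<zero>"
  using t_pow_Units[of n] by (auto simp: field_Units)

lemma t_pow_add: "t [^] (m + n :: int) = t [^] m \<otimes> t [^] n"
  using int_pow_mult_Units t_Units .

lemma t_pow_one: "t [^] (1::int) = t"
  using t_closed by (simp add: int_pow_def2 del: pow_nat)

lemma t_pow_inv: "inv (t [^] (n::int)) = t [^] (- n)"
proof (rule comm_inv_char)
  show "t [^] n \<otimes> t [^] - n = \<one>" using t_pow_add[of n "- n"] by simp
qed (rule t_pow_closed)+

lemma t_pow_in_R: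
  assumes "0 \<le> (n::int)" shows "t [^] n \<in> R"
  using t_nat_pow_in_R[of "nat n"] assms by simp

text \<open>The elements \<open>x\<close> with some \<open>t\<^sup>kx \<in> R\<close> form a ring containing \<open>R\<close> and \<open>t\<inverse>\<close>; by
  \<open>E = R[t\<inverse>]\<close> they exhaust \<open>E\<close>.\<close>

lemma denominator_exists:
  assumes "x \<in> carrier E"
  shows "\<exists>k::nat. t [^] k \<otimes> x \<in> R"
proof -
  have "x \<in> carrier E \<and> (\<exists>k::nat. t [^] k \<otimes> x \<in> R)"
    if "x \<in> generate_ring E (R \<union> {inv t})" for x
    using that
  proof (induction rule: generate_ring.induct)
    case one
    show ?case using R_simps(2) by (auto intro!: exI[of _ 0])
  next
    case (incl h)
    then consider "h \<in> R" | "h = inv t" by blast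
    then show ?case
    proof cases
      case 1
      then show ?thesis using R_closed by (auto intro!: exI[of _ 0])
    next
      case 2
      then show ?thesis using t_Units R_simps(2) by (auto intro!: exI[of _ 1] simp: Units_closed)
    qed
  next
    case (a_inv h)
    then obtain k :: nat where "h \<in> carrier E" "t [^] k \<otimes> h \<in> R" by blast
    then show ?case using R_simps(3) t_closed by (auto simp: r_minus intro!: exI[of _ k])
  next
    case (eng_add x y)
    then obtain k l :: nat where h: "x \<in> carrier E" "y \<in> carrier E"
      "t [^] k \<otimes> x \<in> R" "t [^] l \<otimes> y \<in> R" by blast
    have p: "t [^] k \<in> carrier E" "t [^] l \<in> carrier E" using t_closed by auto
    have "t [^] (k + l) \<otimes> (x \<oplus> y)
        = t [^] l \<otimes> (t [^] k \<otimes> x) \<oplus> t [^] k \<otimes> (t [^] l \<otimes> y)"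
      unfolding nat_pow_mult[OF t_closed, symmetric] using h(1,2) p by algebra
    also have "\<dots> \<in> R" using h(3,4) by (simp add: R_simps t_nat_pow_in_R)
    finally show ?case using h(1,2) by auto
  next
    case (eng_mult x y)
    then obtain k l :: nat where h: "x \<in> carrier E" "y \<in> carrier E"
      "t [^] k \<otimes> x \<in> R" "t [^] l \<otimes> y \<in> R" by blast
    have p: "t [^] k \<in> carrier E" "t [^] l \<in> carrier E" using t_closed by auto
    have "t [^] (k + l) \<otimes> (x \<otimes> y) = (t [^] k \<otimes> x) \<otimes> (t [^] l \<otimes> y)"
      unfolding nat_pow_mult[OF t_closed, symmetric] using h(1,2) p by (simp add: m_ac)
    also have "\<dots> \<in> R" using h(3,4) by (rule R_simps)
    finally show ?case using h(1,2) by auto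
  qed
  then show ?thesis using assms generated by blast
qed

subsection \<open>The multiplicative group \<open>Q + tR\<close>\<close>

definition U :: "'a set" where
  "U = Q <+>\<^bsub>E\<^esub> (t <# R)"

lemma U_iff: "u \<in> U \<longleftrightarrow> (\<exists>a\<in>Q. \<exists>r\<in>R. u = a \<oplus> t \<otimes> r)"
  by (auto simp: U_def set_add_def' l_coset_def)

lemma U_I: "a \<in> Q \<Longrightarrow> r \<in> R \<Longrightarrow> a \<oplus> t \<otimes> r \<in> U"
  unfolding U_iff by blast

lemma U_subset_R: "u \<in> U \<Longrightarrow> u \<in> R"
  using Q_subset R_simps t_in_R by (auto simp: U_iff)

lemma Q_subset_U:
  assumes "a \<in> Q" shows "a \<in> U"
proof -
  have "a = a \<oplus> t \<otimes> \<zero>" using Q_Units[OF assms] t_closed by (simp add: Units_closed)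
  then show ?thesis using U_I[OF assms R_simps(1)] by simp
qed

lemma U_mult:
  assumes "u \<in> U" "v \<in> U" shows "u \<otimes> v \<in> U"
proof -
  obtain a r b s where h: "a \<in> Q" "r \<in> R" "u = a \<oplus> t \<otimes> r" "b \<in> Q" "s \<in> R" "v = b \<oplus> t \<otimes> s"
    using assms U_iff by blast
  have R: "a \<in> R" "b \<in> R" using h Q_subset by auto
  have "u \<otimes> v = a \<otimes> b \<oplus> t \<otimes> (a \<otimes> s \<oplus> r \<otimes> b \<oplus> t \<otimes> (r \<otimes> s))"
    unfolding h using h(2,5)[THEN R_closed] R[THEN R_closed] t_closed by algebra
  moreover have "a \<otimes> s \<oplus> r \<otimes> b \<oplus> t \<otimes> (r \<otimes> s) \<in> R" using h R t_in_R R_simps by simp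
  ultimately show ?thesis using U_I[OF Q_mult[OF h(1,4)]] by simp
qed

lemma U_add_tR:
  assumes "u \<in> U" "s \<in> R" shows "u \<oplus> t \<otimes> s \<in> U"
proof -
  obtain a r where h: "a \<in> Q" "r \<in> R" "u = a \<oplus> t \<otimes> r" using assms U_iff by blast
  have "a \<in> carrier E" using h Q_subset R_closed by auto
  then have "u \<oplus> t \<otimes> s = a \<oplus> t \<otimes> (r \<oplus> s)"
    unfolding h using h(2)[THEN R_closed] assms(2)[THEN R_closed] t_closed by algebra
  then show ?thesis using U_I[OF h(1) R_simps(5)[OF h(2) assms(2)]] by simp
qed

lemma U_add:
  assumes "u \<in> U" "v \<in> U" shows "u \<oplus> v \<in> U"
proof -
  obtain a r b s where h: "a \<in> Q" "r \<in> R" "u = a \<oplus> t \<otimes> r" "b \<in> Q" "s \<in> R" "v = b \<oplus> t \<otimes> s"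
    using assms U_iff by blast
  have R: "a \<in> R" "b \<in> R" using h Q_subset by auto
  have "u \<oplus> v = a \<oplus> b \<oplus> t \<otimes> (r \<oplus> s)"
    unfolding h using h(2,5)[THEN R_closed] R[THEN R_closed] t_closed by algebra
  then show ?thesis using U_I[OF Q_add[OF h(1,4)] R_simps(5)[OF h(2,5)]] by simp
qed

text \<open>If \<open>a + tr = 0\<close>, then \<open>1 = t(-a\<inverse>r)\<close>; here \<open>a\<inverse>\<close> belongs to \<open>R\<close>, so this
  contradicts \<open>1 \<notin> tR\<close>.\<close>

lemma zero_notin_U: "\<zero> \<notin> U"
proof
  assume "\<zero> \<in> U"
  then obtain a r where h: "a \<in> Q" "r \<in> R" "\<zero> = a \<oplus> t \<otimes> r" using U_iff by blast
  have i: "inv a \<in> R" using h Q_inv Q_subset by blast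
  have c: "a \<in> carrier E" "inv a \<in> carrier E" "r \<in> carrier E" "inv a \<otimes> a = \<one>"
    using h(2) i Q_Units[OF h(1)] R_closed by (auto simp: Units_closed)
  have "t \<otimes> (\<ominus> (inv a \<otimes> r)) = inv a \<otimes> a \<ominus> inv a \<otimes> (a \<oplus> t \<otimes> r)"
    using c(1-3) t_closed by algebra
  also have "\<dots> = \<one>" using c by (simp add: h(3)[symmetric] minus_eq)
  finally have "\<one> = t \<otimes> (\<ominus> (inv a \<otimes> r))" by simp
  moreover have "\<ominus> (inv a \<otimes> r) \<in> R" using i h(2) by (simp add: R_simps)
  ultimately have "\<one> \<in> t <# R" unfolding l_coset_def by blast
  then show False using one_notin_tR by blast
qed

text \<open>Cancelling powers of \<open>t\<close> one at a time: from \<open>us = t\<^sup>k\<^sup>+\<^sup>1\<close> with \<open>u = a + tr\<close>,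
  \<open>as = t(t\<^sup>k - rs)\<close>, so \<open>s\<close> is itself divisible by \<open>t\<close> in \<open>R\<close>.\<close>

lemma divisor_of_t_pow_in_U:
  assumes "u \<in> U" "s \<in> R" "u \<otimes> s = t [^] (k::nat)"
  shows "\<exists>w\<in>R. u \<otimes> w = \<one>"
  using assms(2,3)
proof (induction k arbitrary: s)
  case 0
  then show ?case by auto
next
  case (Suc k)
  obtain a r where h: "a \<in> Q" "r \<in> R" "u = a \<oplus> t \<otimes> r" using assms(1) U_iff by blast
  have i: "inv a \<in> R" using h Q_inv Q_subset by blast
  have c: "a \<in> carrier E" "inv a \<in> carrier E" "r \<in> carrier E" "s \<in> carrier E"
    "t [^] k \<in> carrier E" "u \<in> carrier E" and ia: "inv a \<otimes> a = \<one>"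
    using h(2) i Q_Units[OF h(1)] R_closed Suc.prems(1) t_closed U_subset_R assms(1)
    by (auto simp: Units_closed)
  define s' where "s' = inv a \<otimes> (t [^] k \<ominus> r \<otimes> s)"
  have s': "s' \<in> R" using i h Suc.prems t_nat_pow_in_R R_simps R_diff by (simp add: s'_def)
  have "t \<otimes> s' = inv a \<otimes> (t [^] Suc k \<ominus> t \<otimes> r \<otimes> s)"
    unfolding s'_def nat_pow_Suc using c t_closed by algebra
  also have "\<dots> = inv a \<otimes> (u \<otimes> s \<ominus> t \<otimes> r \<otimes> s)" using Suc.prems by simp
  also have "\<dots> = (inv a \<otimes> a) \<otimes> s" unfolding h(3) using c(1-5) t_closed by algebra
  finally have ts': "t \<otimes> s' = s" using ia c by simp
  have "t \<otimes> (u \<otimes> s') = u \<otimes> (t \<otimes> s')" using c t_closed R_closed[OF s'] by algebra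
  also have "\<dots> = t \<otimes> t [^] k" using ts' Suc.prems c t_closed by (simp add: m_comm)
  finally have "u \<otimes> s' = t [^] k"
    using m_lcancel[OF t_nonzero t_closed] c R_closed[OF s'] by simp
  then show ?case using Suc.IH s' by blast
qed

text \<open>Once \<open>w = u\<inverse>\<close> is known to lie in \<open>R\<close>, the equation \<open>(a + tr)w = 1\<close> says that \<open>w\<close> agrees
  with \<open>a\<inverse>\<close> modulo \<open>tR\<close>.\<close>

lemma U_inv:
  assumes "u \<in> U" shows "inv u \<in> U"
proof -
  have u: "u \<in> carrier E" "u \<noteq> \<zero>"
    using U_subset_R R_closed zero_notin_U assms by auto
  then have uU: "u \<in> Units E" by (simp add: field_Units)
  obtain k :: nat where k: "t [^] k \<otimes> inv u \<in> R"
    using denominator_exists[of "inv u"] uU by auto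
  have "u \<otimes> (t [^] k \<otimes> inv u) = t [^] k"
    using uU u t_closed m_lcomm[of u "t [^] k" "inv u"] by simp
  then obtain w where w: "w \<in> R" "u \<otimes> w = \<one>"
    using divisor_of_t_pow_in_U[OF assms k] by blast
  have inv: "inv u = w" using comm_inv_char[OF u(1) R_closed[OF w(1)] w(2)] .
  obtain a r where h: "a \<in> Q" "r \<in> R" "u = a \<oplus> t \<otimes> r" using assms U_iff by blast
  have i: "inv a \<in> R" using h Q_inv Q_subset by blast
  have c: "a \<in> carrier E" "inv a \<in> carrier E" "r \<in> carrier E" "w \<in> carrier E"
    and ia: "inv a \<otimes> a = \<one>"
    using h(2) i Q_Units[OF h(1)] R_closed w by (auto simp: Units_closed)
  \<comment> \<open>Solve \<open>aw + trw = 1\<close> for the first \<open>w\<close>.\<close>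
  have "w = (inv a \<otimes> a) \<otimes> w" using ia c by simp
  also have "\<dots> = inv a \<otimes> (u \<otimes> w) \<oplus> t \<otimes> (\<ominus> (inv a \<otimes> r \<otimes> w))"
    unfolding h(3) using c t_closed by algebra
  also have "\<dots> = inv a \<oplus> t \<otimes> (\<ominus> (inv a \<otimes> r \<otimes> w))" using w c by simp
  finally have "w = inv a \<oplus> t \<otimes> (\<ominus> (inv a \<otimes> r \<otimes> w))" .
  moreover have "\<ominus> (inv a \<otimes> r \<otimes> w) \<in> R" using i h w R_simps by simp
  ultimately show ?thesis unfolding inv using U_I[OF Q_inv[OF h(1)]] by metis
qed

subsection \<open>The cone\<close>

definition P :: "'a set" where
  "P = {t [^] n \<otimes> u | (n::int) u. u \<in> U}"

lemma P_I: "u \<in> U \<Longrightarrow> t [^] (n::int) \<otimes> u \<in> P"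
  by (auto simp: P_def)

lemma P_closed: "x \<in> P \<Longrightarrow> x \<in> carrier E"
  using t_pow_closed U_subset_R R_closed by (auto simp: P_def)

lemma zero_notin_P: "\<zero> \<notin> P"
proof
  assume "\<zero> \<in> P"
  then obtain n :: int and u where "u \<in> U" "t [^] n \<otimes> u = \<zero>" by (auto simp: P_def)
  then show False
    using zero_notin_U t_pow_nonzero[of n] t_pow_closed[of n] integral U_subset_R R_closed by metis
qed

lemma t_pow_in_P: "t [^] (n::int) \<in> P"
  using P_I[OF Q_subset_U[OF one_in_Q], of n] t_pow_closed by simp

lemma P_mult:
  assumes "x \<in> P" "y \<in> P" shows "x \<otimes> y \<in> P"
proof -
  obtain m n :: int and u v where h: "u \<in> U" "v \<in> U" "x = t [^] m \<otimes> u" "y = t [^] n \<otimes> v"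
    using assms by (auto simp: P_def)
  have "x \<otimes> y = t [^] (m + n) \<otimes> (u \<otimes> v)"
    unfolding h t_pow_add
    using t_pow_closed[of m] t_pow_closed[of n] h(1,2)[THEN U_subset_R, THEN R_closed] by algebra
  then show ?thesis using P_I U_mult h by simp
qed

text \<open>The summand with the smaller power of \<open>t\<close> decides: after factoring that power out, the
  other summand lies in \<open>U\<close> or in \<open>tR\<close>, and \<open>U\<close> absorbs both.\<close>

lemma P_add:
  assumes "x \<in> P" "y \<in> P" shows "x \<oplus> y \<in> P"
proof -
  have main: "t [^] m \<otimes> u \<oplus> t [^] n \<otimes> v \<in> P"
    if "u \<in> U" "v \<in> U" "m \<le> n" for m n :: int and u v
  proof -
    have c: "u \<in> carrier E" "v \<in> carrier E" using that U_subset_R R_closed by auto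
    have "t [^] n = t [^] m \<otimes> t [^] (n - m)" using t_pow_add[of m "n - m"] by simp
    then have eq: "t [^] m \<otimes> u \<oplus> t [^] n \<otimes> v = t [^] m \<otimes> (u \<oplus> t [^] (n - m) \<otimes> v)"
      using c t_pow_closed by (simp add: r_distr m_assoc)
    have "u \<oplus> t [^] (n - m) \<otimes> v \<in> U"
    proof (cases "m = n")
      case True
      then show ?thesis using U_add that c by simp
    next
      case False
      have "t [^] (n - m) = t \<otimes> t [^] (n - m - 1)"
        using t_pow_add[of 1 "n - m - 1"] t_pow_one by simp
      then have "t [^] (n - m) \<otimes> v = t \<otimes> (t [^] (n - m - 1) \<otimes> v)"
        using c t_pow_closed t_closed by (simp add: m_assoc)
      moreover have "t [^] (n - m - 1) \<otimes> v \<in> R"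
        using False that t_pow_in_R U_subset_R R_simps by simp
      ultimately show ?thesis using U_add_tR that by simp
    qed
    then show ?thesis unfolding eq by (rule P_I)
  qed
  obtain m n :: int and u v where h: "u \<in> U" "v \<in> U" "x = t [^] m \<otimes> u" "y = t [^] n \<otimes> v"
    using assms by (auto simp: P_def)
  show ?thesis
  proof (cases "m \<le> n")
    case True
    then show ?thesis using main h by simp
  next
    case False
    then have "y \<oplus> x \<in> P" using main[OF h(2,1), of n m] h by simp
    then show ?thesis using assms P_closed by (simp add: a_comm)
  qed
qed

lemma P_inv:
  assumes "x \<in> P" shows "inv x \<in> P"
proof -
  obtain n :: int and u where h: "u \<in> U" "x = t [^] n \<otimes> u" using assms by (auto simp: P_def)
  have u: "u \<in> carrier E" "u \<in> Units E"
    using h U_subset_R R_closed zero_notin_U by (auto simp: field_Units)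
  have "t [^] n \<otimes> t [^] - n = \<one>" using t_pow_add[of n "- n"] by simp
  then have "x \<otimes> (t [^] (- n) \<otimes> inv u) = \<one>"
    using h(2) u t_pow_closed[of n] t_pow_closed[of "- n"]
    by (simp add: m_assoc m_lcomm[of u])
  then have "inv x = t [^] (- n) \<otimes> inv u"
    using comm_inv_char[OF P_closed[OF assms]] u t_pow_closed by simp
  then show ?thesis using P_I U_inv[OF h(1)] by simp
qed

text \<open>Multiplied by \<open>t\<^sup>m\<^sup>+\<^sup>1\<close>, both elements become \<open>1 \<plusminus> t(t\<^sup>mz)\<close>, which lie in \<open>1 + tR\<close>.\<close>

lemma t_pow_dominates:
  assumes z: "z \<in> carrier E" and m: "t [^] (m::int) \<otimes> z \<in> R"
  shows "t [^] (- (m + 1)) \<oplus> z \<in> P" and "t [^] (- (m + 1)) \<ominus> z \<in> P"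
proof -
  define y where "y = t [^] m \<otimes> z"
  define p where "p = t [^] (- (m + 1))"
  have y: "y \<in> R" "y \<in> carrier E" and p: "p \<in> carrier E"
    using m R_closed t_pow_closed by (auto simp: y_def p_def)
  have one: "\<one> \<in> U" by (rule Q_subset_U[OF one_in_Q])
  have "p \<otimes> (t \<otimes> y) = t [^] (- (m + 1) + 1 + m) \<otimes> z"
    unfolding p_def y_def t_pow_add t_pow_one
    using t_pow_closed t_closed z by (simp add: m_assoc)
  then have pty: "p \<otimes> (t \<otimes> y) = z" using z by simp
  have "p \<oplus> p \<otimes> (t \<otimes> y) = p \<otimes> (\<one> \<oplus> t \<otimes> y)" "p \<ominus> p \<otimes> (t \<otimes> y) = p \<otimes> (\<one> \<oplus> t \<otimes> (\<ominus> y))"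
    using p y t_closed by algebra+
  then have eq: "p \<oplus> z = p \<otimes> (\<one> \<oplus> t \<otimes> y)" "p \<ominus> z = p \<otimes> (\<one> \<oplus> t \<otimes> (\<ominus> y))"
    by (simp_all only: pty)
  show "t [^] (- (m + 1)) \<oplus> z \<in> P" "t [^] (- (m + 1)) \<ominus> z \<in> P"
    using eq P_I U_add_tR[OF one] y R_simps(3) unfolding p_def by simp_all
qed

text \<open>If \<open>x\<close> and \<open>-x\<close> were both in \<open>P\<close>, so would be their sum \<open>0\<close>. Directedness holds
  because suitable powers of \<open>t\<close>, all in \<open>P\<close>, dominate any given element and its negative.\<close>

lemma directed_cone: "positive_cone_of_directed_ring_order E (insert \<zero> P)"
proof -
  have cone: "positive_cone E (insert \<zero> P)"
  proof (rule positive_coneI)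
    fix x assume x: "x \<in> insert \<zero> P" "\<ominus> x \<in> insert \<zero> P"
    show "x = \<zero>"
    proof (rule ccontr)
      assume nz: "x \<noteq> \<zero>"
      then have "x \<in> P" using x by blast
      moreover from this have c: "x \<in> carrier E" by (rule P_closed)
      moreover have "\<ominus> x \<noteq> \<zero>" using nz c by (metis minus_minus minus_zero)
      ultimately have "x \<oplus> \<ominus> x \<in> P" using P_add x by blast
      then show False using zero_notin_P c by (simp add: r_neg)
    qed
  qed (auto simp: P_closed P_add P_mult)
  have "\<exists>p\<in>insert \<zero> P. p \<oplus> z \<in> insert \<zero> P \<and> p \<ominus> z \<in> insert \<zero> P"
    if z: "z \<in> carrier E" for z
  proof -
    obtain k :: nat where "t [^] k \<otimes> z \<in> R" using denominator_exists z by blast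
    then have "t [^] (int k) \<otimes> z \<in> R" by (simp add: int_pow_int)
    then show ?thesis using t_pow_dominates z t_pow_in_P by blast
  qed
  then show ?thesis
    unfolding positive_cone_of_directed_ring_order_def
    using cone ring_order_cone_order directed_cone_order by blast
qed

lemma set_inv_P: "set_inv P = P"
proof (intro equalityI subsetI)
  fix x assume "x \<in> set_inv P"
  then show "x \<in> P" using P_inv by (auto simp: SET_INV_def)
next
  fix x assume x: "x \<in> P"
  then have "x \<in> Units E" using P_closed zero_notin_P by (auto simp: field_Units)
  then have "x = inv (inv x)" by simp
  then show "x \<in> set_inv P" using P_inv[OF x] unfolding SET_INV_def by blast
qed

end

section \<open>The directed order on \<open>E\<close>\<close>

theorem theorem2p2:
  fixes E :: "('a, 'b) ring_scheme" (structure)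
    and R F :: "'a set"
    and ord :: "'a rel"
    and t :: 'a
  assumes "field E"
    and "subring R E"
    and "t \<in> R" and "t \<noteq> \<zero>"
    and "\<one> \<notin> t <# R"
    and "carrier E = generate_ring E (R \<union> {inv t})"
    and "totally_ordered_subfield E F ord" and "F \<subseteq> R"
  shows "positive_cone_of_directed_ring_order E (P_cone E R F ord t) \<and>
    \<one> \<in> P_cone E R F ord t \<and>
    set_inv (P_cone E R F ord t - {\<zero>}) = P_cone E R F ord t - {\<zero>} \<and>
    (\<forall>z\<in>carrier E. \<forall>m::int. 0 \<le> m \<longrightarrow> t [^] m \<otimes> z \<in> R \<longrightarrow>
       (let N = m + 1 in
          t [^] (- N) \<oplus> z \<in> P_cone E R F ord t - {\<zero>} \<and>
          t [^] (- N) \<ominus> z \<in> P_cone E R F ord t - {\<zero>}))"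
proof -
  interpret field E by fact
  have F: "totally_ordered_subfield E F ord" by fact
  interpret C: positive_leading_coefficients E R t "positive_elements E F ord"
  proof (intro positive_leading_coefficients.intro positive_leading_coefficients_axioms.intro)
    show "positive_elements E F ord \<subseteq> R" "\<zero> \<notin> positive_elements E F ord"
      using \<open>F \<subseteq> R\<close> by (auto simp: positive_elements_def)
  qed (fact assms positive_elements_one[OF F] positive_elements_add[OF F]
        positive_elements_mult[OF F] positive_elements_inv[OF F])+
  \<comment> \<open>The exponents of \<open>P_cone\<close> carry a sign, so the union is reindexed by \<open>n \<mapsto> -n\<close>.\<close>
  have eq: "P_cone E R F ord t = insert \<zero> C.P"
  proof -
    have "(\<Union>n::int. t [^] (- n) <# C.U) = C.P"
    proof (intro equalityI subsetI)
      fix x assume "x \<in> C.P"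
      then obtain n :: int and u where "u \<in> C.U" "x = t [^] (- (- n)) \<otimes> u"
        by (auto simp: C.P_def)
      then show "x \<in> (\<Union>n::int. t [^] (- n) <# C.U)" unfolding l_coset_def by blast
    qed (auto simp: l_coset_def C.P_I)
    then show ?thesis by (simp add: P_cone_def C.U_def)
  qed
  have "\<one> \<in> C.P" using C.t_pow_in_P[of 0] by simp
  moreover have "insert \<zero> C.P - {\<zero>} = C.P" using C.zero_notin_P by blast
  ultimately show ?thesis
    using C.directed_cone C.set_inv_P C.t_pow_dominates unfolding eq Let_def by auto
qed

end
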